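(* Let $\nu>-1$. (a) The system $\{d_\nu\varphi_n^\nu : n\ge 2\}$ is orthogonal in $L^2(d\eta_\nu)$. (b) The system $\{\delta_\nu\phi_n^\nu : n\ge 2\}$ is orthogonal in $L^2(d\mu_\nu)$. (c) The system $\{\mathbb{D}_\nu\psi_n^\nu : n\ge 2\}$ is orthogonal in $L^2(dx)$.
   Context: All $L^p$ spaces are over the interval $(0,1)$. For $\nu>-1$ let $J_\nu$ be the Bessel function of the first kind of order $\nu$ on $(0,\infty)$, and let $0<\lambda_{1,\nu}<\lambda_{2,\nu}<\dots$ be its successive positive zeros. For $n\ge1$ and $x\in(0,1)$ set $$\phi_n^\nu(x)=\frac{\sqrt2}{|J_{\nu+1}(\lambda_{n,\nu})|}x^{-\nu}J_\nu(\lambda_{n,\nu}x),\qquad \psi_n^\nu(x)=x^{\nu+1/2}\phi_n^\nu(x),\qquad \varphi_n^\nu(x)=\frac{\phi_n^\nu(x)}{\phi_1^\nu(x)}.$$ These are orthonormal bases of $L^2(d\mu_\nu)$, $L^2(dx)$ and $L^2(d\eta_\nu)$, respectively, where $d\mu_\nu(x)=x^{2\nu+1}dx$ and $d\eta_\nu(x)=x^{2\nu+1}[\phi_1^\nu(x)]^2dx$ on $(0,1)$. Let $$R^\nu(x)=\lambda_{1,\nu}\frac{J_{\nu+1}(\lambda_{1,\nu}x)}{J_\nu(\lambda_{1,\nu}x)},\qquad x\in(0,1),$$ and define the derivatives $$d_\nu=\frac{d}{dx},\qquad \delta_\nu=\frac{d}{dx}+R^\nu(x),\qquad \mathbb{D}_\nu=\frac{d}{dx}-\frac{\nu+1/2}{x}+R^\nu(x).$$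 *)

theory Defs
  imports "HOL-Analysis.Analysis"
begin

text \<open>The Bessel function of the first kind, meant for real order \<open>\<nu> > -1\<close> and argument \<open>x > 0\<close>;
  its values for \<open>x \<le> 0\<close> are not meaningful.\<close>

definition Bessel_J :: "real \<Rightarrow> real \<Rightarrow> real" where
  "Bessel_J \<nu> x =
     (\<Sum>k. (-1) ^ k / (fact k * Gamma (real k + \<nu> + 1)) * (x / 2) powr (2 * real k + \<nu>))"

text \<open>The \<open>n\<close>-th positive zero in increasing order, for \<open>n \<ge> 1\<close>: the positive zero \<open>z\<close> such that
  exactly \<open>n\<close> zeros lie in \<open>(0, z]\<close>. As \<open>n \<ge> 1\<close>, the cardinality condition forces that set to
  be finite.\<close>

definition Bessel_zero :: "real \<Rightarrow> nat \<Rightarrow> real" where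
  "Bessel_zero \<nu> n =
     (THE z. 0 < z \<and> Bessel_J \<nu> z = 0 \<and> card {y. 0 < y \<and> y \<le> z \<and> Bessel_J \<nu> y = 0} = n)"

definition phi :: "real \<Rightarrow> nat \<Rightarrow> real \<Rightarrow> real" where
  "phi \<nu> n x = sqrt 2 / \<bar>Bessel_J (\<nu> + 1) (Bessel_zero \<nu> n)\<bar>
                 * x powr (- \<nu>) * Bessel_J \<nu> (Bessel_zero \<nu> n * x)"

definition psi :: "real \<Rightarrow> nat \<Rightarrow> real \<Rightarrow> real" where
  "psi \<nu> n x = x powr (\<nu> + 1 / 2) * phi \<nu> n x"

definition varphi :: "real \<Rightarrow> nat \<Rightarrow> real \<Rightarrow> real" where
  "varphi \<nu> n x = phi \<nu> n x / phi \<nu> 1 x"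

definition dx_measure :: "real measure" where
  "dx_measure = restrict_space lborel {0<..<1}"

definition mu_measure :: "real \<Rightarrow> real measure" where
  "mu_measure \<nu> = density dx_measure (\<lambda>x. ennreal (x powr (2 * \<nu> + 1)))"

definition eta_measure :: "real \<Rightarrow> real measure" where
  "eta_measure \<nu> = density dx_measure (\<lambda>x. ennreal (x powr (2 * \<nu> + 1) * (phi \<nu> 1 x)\<^sup>2))"

definition R_fun :: "real \<Rightarrow> real \<Rightarrow> real" where
  "R_fun \<nu> x = Bessel_zero \<nu> 1 * Bessel_J (\<nu> + 1) (Bessel_zero \<nu> 1 * x)
                 / Bessel_J \<nu> (Bessel_zero \<nu> 1 * x)"

definition d_op :: "real \<Rightarrow> (real \<Rightarrow> real) \<Rightarrow> real \<Rightarrow> real" where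
  "d_op \<nu> f x = deriv f x"

definition delta_op :: "real \<Rightarrow> (real \<Rightarrow> real) \<Rightarrow> real \<Rightarrow> real" where
  "delta_op \<nu> f x = deriv f x + R_fun \<nu> x * f x"

definition D_op :: "real \<Rightarrow> (real \<Rightarrow> real) \<Rightarrow> real \<Rightarrow> real" where
  "D_op \<nu> f x = deriv f x - (\<nu> + 1 / 2) / x * f x + R_fun \<nu> x * f x"

definition in_L2 :: "'a measure \<Rightarrow> ('a \<Rightarrow> real) \<Rightarrow> bool" where
  "in_L2 M f \<longleftrightarrow> f \<in> borel_measurable M \<and> integrable M (\<lambda>x. (f x)\<^sup>2)"

text \<open>Orthogonality of an indexed family: distinctness is required of the indices, not of the
  functions.\<close>

definition orthogonal_system_L2 :: "'a measure \<Rightarrow> 'i set \<Rightarrow> ('i \<Rightarrow> 'a \<Rightarrow> real) \<Rightarrow> bool" where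
  "orthogonal_system_L2 M I F \<longleftrightarrow>
     (\<forall>n\<in>I. in_L2 M (F n)) \<and>
     (\<forall>m\<in>I. \<forall>n\<in>I. m \<noteq> n \<longrightarrow> (\<integral>x. F m x * F n x \<partial>M) = 0)"

end

theory Submission
  imports Defs
begin

text \<open>
  Writing \<open>J\<^sub>\<nu>(x) = (x/2)\<^sup>\<nu> g(x\<^sup>2/4)\<close> with \<open>g\<close> entire, \<open>\<phi>\<^sub>n\<close> is a multiple of
  \<open>u\<^sub>n(x) = g(\<lambda>\<^sub>n\<^sup>2 x\<^sup>2/4)\<close>, which solves \<open>(p u')' = - \<lambda>\<^sub>n\<^sup>2 p u\<close> for \<open>p(x) = x\<close> to the power
  \<open>2\<nu>+1\<close>. Up to the weights and constant factors, all three systems equal \<open>w\<^sub>n/u\<^sub>1\<close>, where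
  \<open>w\<^sub>n = u\<^sub>n'u\<^sub>1 - u\<^sub>nu\<^sub>1'\<close>. As \<open>(p w\<^sub>n)' = - (\<lambda>\<^sub>n\<^sup>2 - \<lambda>\<^sub>1\<^sup>2) p u\<^sub>n u\<^sub>1\<close>, the function
  \<open>G\<^sub>m\<^sub>n = p w\<^sub>m u\<^sub>n/u\<^sub>1\<close> satisfies \<open>G\<^sub>m\<^sub>n' = p w\<^sub>m w\<^sub>n/u\<^sub>1\<^sup>2 - (\<lambda>\<^sub>m\<^sup>2 - \<lambda>\<^sub>1\<^sup>2) p u\<^sub>m u\<^sub>n\<close>, so that a
  combination of \<open>G\<^sub>m\<^sub>n\<close> and \<open>G\<^sub>n\<^sub>m\<close> is an antiderivative of \<open>p w\<^sub>m w\<^sub>n/u\<^sub>1\<^sup>2\<close> that vanishes at both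
  end points (at \<open>1\<close> because the zeros of \<open>g\<close> are simple).

  That the \<open>\<lambda>\<^sub>n\<close> exist also needs proof: the zeros are isolated since they are simple, and there are
  infinitely many by Sturm comparison of \<open>\<surd>x J\<^sub>\<nu>(x)\<close> with \<open>sin (x/2)\<close>.
\<close>

section \<open>The power series behind the Bessel function, and its recurrences\<close>

definition bes_coeff :: "real \<Rightarrow> nat \<Rightarrow> real" where
  "bes_coeff \<nu> k = (-1) ^ k / (fact k * Gamma (real k + \<nu> + 1))"

text \<open>This is \<open>g\<close> of the overview, the Bessel-Clifford function of order
  \<open>\<nu>\<close> evaluated at \<open>- t\<close>. Working with it avoids the power of
  \<open>x\<close> that makes the Bessel function irregular at 0.\<close>

definition bes :: "real \<Rightarrow> real \<Rightarrow> real" where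
  "bes \<nu> t = (\<Sum>k. bes_coeff \<nu> k * t ^ k)"

lemma Gamma_shift:
  assumes "\<nu> > -1"
  shows "Gamma (real k + \<nu> + 2) = (real k + \<nu> + 1) * Gamma (real k + \<nu> + 1)"
  using Gamma_plus1[of "real k + \<nu> + 1"] assms
  by (auto simp: nonpos_Ints_def add_ac)

lemma bes_coeff_Suc:
  assumes "\<nu> > -1"
  shows "bes_coeff \<nu> (Suc k) = - bes_coeff \<nu> k / ((real k + 1) * (real k + \<nu> + 1))"
  using Gamma_shift[OF assms, of k] by (simp add: bes_coeff_def field_simps add_ac)

lemma bes_coeff_shift:
  assumes "\<nu> > -1"
  shows "bes_coeff \<nu> k = (real k + \<nu> + 1) * bes_coeff (\<nu> + 1) k"
proof -
  have "real k + (\<nu> + 1) + 1 = real k + \<nu> + 2" by simp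
  moreover have "real k + \<nu> + 1 \<noteq> 0" using assms by linarith
  ultimately show ?thesis
    unfolding bes_coeff_def by (simp only: Gamma_shift[OF assms]) simp
qed

lemma diffs_bes_coeff: "diffs (bes_coeff \<nu>) k = - bes_coeff (\<nu> + 1) k"
proof -
  have eq: "real (Suc k) + \<nu> + 1 = real k + (\<nu> + 1) + 1" by simp
  have "real (Suc k) \<noteq> 0" by simp
  thus ?thesis unfolding diffs_def bes_coeff_def eq by (simp del: of_nat_Suc)
qed

lemma summable_bes:
  assumes "\<nu> > -1"
  shows "summable (\<lambda>k. bes_coeff \<nu> k * t ^ k)"
proof (rule summable_ratio_test)
  \<comment> \<open>From \<open>N\<close> on,
    \<open>2 * \<bar>t\<bar> \<le> n * (\<nu> + 1)\<close>, which bounds the ratio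
    \<open>\<bar>t\<bar> / ((n + 1) * (n + \<nu> + 1))\<close> of successive terms by 1/2.\<close>
  define N where "N = nat \<lceil>2 * \<bar>t\<bar> / (\<nu> + 1)\<rceil>"
  show "(1/2::real) < 1" by simp
  show "norm (bes_coeff \<nu> (Suc n) * t ^ Suc n) \<le> 1/2 * norm (bes_coeff \<nu> n * t ^ n)"
    if "n \<ge> N" for n
  proof -
    have "2 * \<bar>t\<bar> / (\<nu> + 1) \<le> real n" using that by (simp add: N_def)
    hence "2 * \<bar>t\<bar> \<le> real n * (\<nu> + 1)" using assms by (simp add: field_simps)
    also have "\<dots> \<le> (real n + 1) * (real n + \<nu> + 1)"
      using assms by (intro mult_mono) auto
    finally have "2 * \<bar>t\<bar> \<le> (real n + 1) * (real n + \<nu> + 1)" .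
    moreover have "(real n + 1) * (real n + \<nu> + 1) > 0" using assms by (intro mult_pos_pos) auto
    ultimately have *: "\<bar>t\<bar> / ((real n + 1) * (real n + \<nu> + 1)) \<le> 1/2"
      by (simp add: pos_divide_le_eq)
    have "norm (bes_coeff \<nu> (Suc n) * t ^ Suc n)
        = \<bar>t\<bar> / ((real n + 1) * (real n + \<nu> + 1)) * norm (bes_coeff \<nu> n * t ^ n)"
      using assms by (simp add: bes_coeff_Suc abs_mult power_abs)
    also have "\<dots> \<le> 1/2 * norm (bes_coeff \<nu> n * t ^ n)"
      by (intro mult_right_mono *) auto
    finally show ?thesis .
  qed
qed

lemma bes_deriv:
  assumes "\<nu> > -1"
  shows "(bes \<nu> has_real_derivative - bes (\<nu> + 1) t) (at t)"
proof -
  have "((\<lambda>t. \<Sum>k. bes_coeff \<nu> k * t ^ k) has_field_derivative (\<Sum>k. diffs (bes_coeff \<nu>) k * t ^ k)) (at t)"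
    by (intro termdiffs_strong'[where K = "\<bar>t\<bar> + 1"] summable_bes assms) auto
  also have "(\<Sum>k. diffs (bes_coeff \<nu>) k * t ^ k) = - bes (\<nu> + 1) t"
    using summable_bes[of "\<nu> + 1" t] assms by (simp add: diffs_bes_coeff bes_def suminf_minus)
  finally show ?thesis by (simp add: bes_def[abs_def])
qed

lemma isCont_bes: "\<nu> > -1 \<Longrightarrow> isCont (bes \<nu>) t"
  using bes_deriv DERIV_isCont by blast

text \<open>The classical three-term recurrence between the Bessel functions of orders
  \<open>\<nu>\<close>, \<open>\<nu> + 1\<close> and \<open>\<nu> + 2\<close>, in the variable
  \<open>t = x\<^sup>2/4\<close>. On the right the coefficient of \<open>t ^ k\<close> is
  \<open>- k * bes_coeff (\<nu> + 1) k\<close>; it vanishes at \<open>k = 0\<close>, so the index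
  can be shifted.\<close>

lemma bes_recurrence:
  assumes "\<nu> > -1"
  shows "t * bes (\<nu> + 2) t = (\<nu> + 1) * bes (\<nu> + 1) t - bes \<nu> t"
proof -
  have s: "summable (\<lambda>k. bes_coeff \<nu> k * t ^ k)" "summable (\<lambda>k. bes_coeff (\<nu>+1) k * t ^ k)"
     "summable (\<lambda>k. bes_coeff (\<nu>+2) k * t ^ k)"
    using assms by (auto intro!: summable_bes)
  define f where "f k = (\<nu> + 1) * (bes_coeff (\<nu>+1) k * t ^ k) - bes_coeff \<nu> k * t ^ k" for k
  have f: "f sums ((\<nu> + 1) * bes (\<nu> + 1) t - bes \<nu> t)"
    unfolding f_def bes_def using s by (intro sums_diff sums_mult summable_sums)
  have feq: "f k = - (real k * bes_coeff (\<nu>+1) k * t ^ k)" for k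
    unfolding f_def bes_coeff_shift[OF assms, of k] by (simp add: algebra_simps)
  have "f (Suc k) = t * (bes_coeff (\<nu>+2) k * t ^ k)" for k
  proof -
    have "real (Suc k) * bes_coeff (\<nu>+1) (Suc k) = - bes_coeff (\<nu>+2) k"
      using diffs_bes_coeff[of "\<nu>+1" k] by (simp add: diffs_def add_ac)
    thus ?thesis unfolding feq by simp
  qed
  moreover have "(\<lambda>k. f (Suc k)) sums ((\<nu> + 1) * bes (\<nu> + 1) t - bes \<nu> t)"
    using f feq[of 0] by (subst sums_Suc_iff) simp
  moreover have "(\<lambda>k. t * (bes_coeff (\<nu>+2) k * t ^ k)) sums (t * bes (\<nu> + 2) t)"
    unfolding bes_def using s by (intro sums_mult summable_sums)
  ultimately show ?thesis using sums_unique2 by simp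
qed

lemma bes_0: "\<nu> > -1 \<Longrightarrow> bes \<nu> 0 > 0"
  unfolding bes_def powser_zero by (simp add: bes_coeff_def)

lemma Bessel_J_eq:
  assumes "\<nu> > -1" "x > 0"
  shows "Bessel_J \<nu> x = (x / 2) powr \<nu> * bes \<nu> (x\<^sup>2 / 4)"
proof -
  have "(x / 2) powr (2 * real k + \<nu>) = (x / 2) powr \<nu> * (x\<^sup>2 / 4) ^ k" for k
  proof -
    have "(x / 2) powr (2 * real k) = (x / 2) ^ (2 * k)"
      using assms powr_realpow[of "x/2" "2*k"] by simp
    also have "\<dots> = (x\<^sup>2 / 4) ^ k" by (simp add: power_mult power_divide)
    finally show ?thesis by (simp add: powr_add)
  qed
  hence "Bessel_J \<nu> x = (\<Sum>k. (x / 2) powr \<nu> * (bes_coeff \<nu> k * (x\<^sup>2 / 4) ^ k))"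
    unfolding Bessel_J_def bes_coeff_def by (intro suminf_cong) simp
  also have "\<dots> = (x / 2) powr \<nu> * bes \<nu> (x\<^sup>2 / 4)"
    unfolding bes_def by (intro suminf_mult summable_bes assms)
  finally show ?thesis .
qed

lemma Bessel_J_zero_iff:
  assumes "\<nu> > -1" "x > 0"
  shows "Bessel_J \<nu> x = 0 \<longleftrightarrow> bes \<nu> (x\<^sup>2 / 4) = 0"
  using assms by (simp add: Bessel_J_eq)

section \<open>Simplicity and isolation of the zeros\<close>

text \<open>
  A Pohozaev-type identity: the function differentiated here vanishes at \<open>0\<close> and at every double zero,
  although it is increasing.
\<close>
lemma bes_energy_deriv:
  assumes "\<nu> > -1" "t > 0"
  shows "((\<lambda>t. t powr (\<nu> + 1) * (t * (bes (\<nu> + 1) t)\<^sup>2 + (bes \<nu> t)\<^sup>2 - \<nu> * bes \<nu> t * bes (\<nu> + 1) t))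
     has_real_derivative t powr \<nu> * (bes \<nu> t)\<^sup>2) (at t)"
proof -
  have d1: "(bes (\<nu>+1) has_real_derivative - bes (\<nu>+2) t) (at t)"
    using bes_deriv[of "\<nu>+1" t] assms by (simp add: add_ac)
  define f g h P where "f = bes \<nu> t" and "g = bes (\<nu> + 1) t" and "h = bes (\<nu> + 2) t"
    and "P = t powr \<nu>"
  have t1: "t powr (\<nu> + 1) = t * P" using assms by (simp add: powr_add P_def)
  have "((\<lambda>t. t powr (\<nu> + 1) * (t * (bes (\<nu> + 1) t)\<^sup>2 + (bes \<nu> t)\<^sup>2 - \<nu> * bes \<nu> t * bes (\<nu> + 1) t))
     has_real_derivative (\<nu> + 1) * P * (t * g\<^sup>2 + f\<^sup>2 - \<nu> * f * g)
       + t powr (\<nu> + 1) * (g\<^sup>2 - 2 * t * g * h - 2 * f * g + \<nu> * g * g + \<nu> * f * h)) (at t)"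
    unfolding f_def g_def h_def P_def using assms(2)
    by (auto intro!: derivative_eq_intros bes_deriv[OF assms(1)] d1 simp: power2_eq_square)
  also have "(\<nu> + 1) * P * (t * g\<^sup>2 + f\<^sup>2 - \<nu> * f * g)
       + t powr (\<nu> + 1) * (g\<^sup>2 - 2 * t * g * h - 2 * f * g + \<nu> * g * g + \<nu> * f * h)
    = P * ((\<nu> + 1) * (t * g\<^sup>2 + f\<^sup>2 - \<nu> * f * g) + t * g\<^sup>2 - 2 * t * g * (t * h) - 2 * t * f * g
       + \<nu> * t * g\<^sup>2 + \<nu> * f * (t * h))"
    unfolding t1 by (simp add: algebra_simps power2_eq_square)
  \<comment> \<open>Since \<open>h\<close> enters only through \<open>t * h\<close>, the recurrence
    eliminates it; all terms containing \<open>g\<close> then cancel.\<close>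
  also have "t * h = (\<nu> + 1) * g - f" unfolding f_def g_def h_def by (rule bes_recurrence[OF assms(1)])
  also have "P * ((\<nu> + 1) * (t * g\<^sup>2 + f\<^sup>2 - \<nu> * f * g) + t * g\<^sup>2 - 2 * t * g * ((\<nu> + 1) * g - f) - 2 * t * f * g
       + \<nu> * t * g\<^sup>2 + \<nu> * f * ((\<nu> + 1) * g - f)) = P * f\<^sup>2"
    by (simp add: algebra_simps power2_eq_square)
  finally show ?thesis by (simp add: P_def f_def)
qed

text \<open>At a double zero \<open>t\<close> the monotone function \<open>Q\<close> would satisfy
  \<open>Q 0 = Q t = 0\<close>, hence be constant in between. Its derivative then forces
  \<open>bes \<nu>\<close> to vanish on \<open>(0, t)\<close>, contradicting
  \<open>bes \<nu> 0 > 0\<close> by continuity.\<close>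

lemma bes_simple_zero:
  assumes "\<nu> > -1" "t > 0" "bes \<nu> t = 0"
  shows "bes (\<nu> + 1) t \<noteq> 0"
proof
  assume 0: "bes (\<nu> + 1) t = 0"
  define Q where "Q = (\<lambda>t. t powr (\<nu> + 1) * (t * (bes (\<nu> + 1) t)\<^sup>2 + (bes \<nu> t)\<^sup>2 - \<nu> * bes \<nu> t * bes (\<nu> + 1) t))"
  have Q0: "Q 0 = 0" "Q t = 0" using 0 assms by (auto simp: Q_def)
  have cb: "continuous_on A (bes \<nu>)" "continuous_on A (bes (\<nu>+1))" for A
    using isCont_bes assms by (auto intro!: continuous_at_imp_continuous_on)
  \<comment> \<open>Continuity reaches the end point 0 because the exponent \<open>\<nu> + 1\<close>
    is positive.\<close>
  have cQ: "continuous_on {0..t} Q"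
    unfolding Q_def using assms by (intro continuous_intros continuous_on_powr' cb) auto
  have dQ: "(Q has_real_derivative s powr \<nu> * (bes \<nu> s)\<^sup>2) (at s)" if "s > 0" for s
    unfolding Q_def by (rule bes_energy_deriv) (use assms that in auto)
  have mono: "Q r \<le> Q s" if "0 \<le> r" "r \<le> s" "s \<le> t" for r s
  proof (rule DERIV_nonneg_imp_increasing_open[OF that(2)])
    show "\<exists>y. DERIV Q x :> y \<and> y \<ge> 0" if "r < x" "x < s" for x
      using dQ[of x] that \<open>0 \<le> r\<close> by (intro exI[of _ "x powr \<nu> * (bes \<nu> x)\<^sup>2"]) auto
    show "continuous_on {r..s} Q" by (rule continuous_on_subset[OF cQ]) (use that in auto)
  qed
  have Qz: "Q s = 0" if "0 < s" "s < t" for s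
    using mono[of 0 s] mono[of s t] Q0 that by auto
  have bz: "bes \<nu> s = 0" if "0 < s" "s < t" for s
  proof -
    have "(Q has_real_derivative 0) (at s)"
      by (rule has_field_derivative_transform_within_open[of "\<lambda>_. 0" _ _ "{0<..<t}"])
        (use Qz that in \<open>simp_all\<close>)
    hence "s powr \<nu> * (bes \<nu> s)\<^sup>2 = 0" using dQ[of s] that DERIV_unique by blast
    thus ?thesis using that by simp
  qed
  have "(bes \<nu> \<longlongrightarrow> bes \<nu> 0) (at_right 0)"
    using isCont_bes[OF assms(1), of 0] by (simp add: isCont_def filterlim_at_split)
  moreover have "eventually (\<lambda>s. bes \<nu> s = 0) (at_right 0)"
    using eventually_at_right[of 0 t] bz assms(2) by auto
  ultimately have "((\<lambda>_. 0) \<longlongrightarrow> bes \<nu> 0) (at_right (0::real))"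
    using tendsto_cong by force
  hence "bes \<nu> 0 = 0" by (simp add: tendsto_const_iff)
  thus False using bes_0[OF assms(1)] by simp
qed

text \<open>Infinitely many zeros would accumulate at some \<open>x\<close>, itself a zero and not
  0. The difference quotients along these zeros are 0, although the derivative at \<open>x\<close>
  is not.\<close>

lemma finite_zeros_bes:
  assumes "\<nu> > -1"
  shows "finite {t. 0 < t \<and> t \<le> b \<and> bes \<nu> t = 0}"
proof (rule ccontr)
  let ?Z = "{t. 0 < t \<and> t \<le> b \<and> bes \<nu> t = 0}"
  assume "infinite ?Z"
  moreover have "?Z \<subseteq> {0..b}" by auto
  ultimately obtain x where x: "x \<in> {0..b}" "x islimpt ?Z"
    using compact_Icc[of 0 b] by (auto simp: compact_eq_Bolzano_Weierstrass)
  have "closed (bes \<nu> -` {0})"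
    by (intro continuous_closed_vimage) (use isCont_bes[OF assms] in auto)
  moreover have "x islimpt (bes \<nu> -` {0})" using x(2) by (rule islimpt_subset) auto
  ultimately have bx: "bes \<nu> x = 0" by (auto simp: closed_limpt)
  have "x \<noteq> 0" using bx bes_0[OF assms] by auto
  hence "x > 0" using x by auto
  hence nz: "- bes (\<nu> + 1) x \<noteq> 0" using bes_simple_zero[OF assms _ bx] by simp
  have "((\<lambda>y. (bes \<nu> y - bes \<nu> x) / (y - x)) \<longlongrightarrow> - bes (\<nu> + 1) x) (at x)"
    using bes_deriv[OF assms, of x] by (simp add: has_field_derivative_iff)
  hence "eventually (\<lambda>y. (bes \<nu> y - bes \<nu> x) / (y - x) \<noteq> 0) (at x)"
    using nz by (rule tendsto_imp_eventually_ne)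
  hence "eventually (\<lambda>y. y \<notin> ?Z) (at x)"
    by eventually_elim (use bx in auto)
  thus False using x(2) by (simp add: islimpt_iff_eventually)
qed

section \<open>The radial functions and their differential equation\<close>

text \<open>With \<open>a = \<lambda>\<^sub>n\<^sup>2/4\<close> this is \<open>u\<^sub>n\<close>. A
  real parameter in place of the index keeps the differential equation independent of the zeros; the
  eigenvalue is \<open>4 * a\<close>.\<close>

definition rad :: "real \<Rightarrow> real \<Rightarrow> real \<Rightarrow> real" where
  "rad \<nu> a x = bes \<nu> (a * x\<^sup>2)"

definition rad' :: "real \<Rightarrow> real \<Rightarrow> real \<Rightarrow> real" where
  "rad' \<nu> a x = - 2 * a * x * bes (\<nu> + 1) (a * x\<^sup>2)"

lemma rad_deriv:
  assumes "\<nu> > -1"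
  shows "(rad \<nu> a has_real_derivative rad' \<nu> a x) (at x)"
proof -
  have "((\<lambda>x. bes \<nu> (a * x\<^sup>2)) has_real_derivative - bes (\<nu> + 1) (a * x\<^sup>2) * (a * (2 * x))) (at x)"
    by (rule DERIV_chain'[of _ _ _ _ "bes \<nu>", OF _ bes_deriv[OF assms], THEN DERIV_cong])
      (auto intro!: derivative_eq_intros)
  thus ?thesis by (simp add: rad_def[abs_def] rad'_def algebra_simps)
qed

text \<open>Bessel's equation in the form \<open>u'' + (2\<nu> + 1)/x u' + 4 a u = 0\<close>; the
  recurrence expresses the order \<open>\<nu> + 2\<close> from the second derivative through the
  lower two.\<close>

lemma rad'_deriv:
  assumes "\<nu> > -1" "x \<noteq> 0"
  shows "(rad' \<nu> a has_real_derivative - (2 * \<nu> + 1) / x * rad' \<nu> a x - 4 * a * rad \<nu> a x) (at x)"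
proof -
  have d: "(rad (\<nu>+1) a has_real_derivative rad' (\<nu>+1) a x) (at x)"
    using assms by (intro rad_deriv) simp
  have e: "rad' \<nu> a = (\<lambda>x. - 2 * a * x * rad (\<nu>+1) a x)" by (simp add: rad'_def rad_def fun_eq_iff)
  have "((\<lambda>x. - 2 * a * x * rad (\<nu>+1) a x) has_real_derivative
      - 2 * a * rad (\<nu>+1) a x + (- 2 * a * x) * rad' (\<nu>+1) a x) (at x)"
    by (auto intro!: derivative_eq_intros d)
  also have "- 2 * a * rad (\<nu>+1) a x + (- 2 * a * x) * rad' (\<nu>+1) a x
     = - 2 * a * bes (\<nu>+1) (a * x\<^sup>2) + 4 * a * (a * x\<^sup>2 * bes (\<nu>+2) (a * x\<^sup>2))"
    by (simp add: rad_def rad'_def power2_eq_square algebra_simps)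
  also have "\<dots> = - (2 * \<nu> + 1) / x * rad' \<nu> a x - 4 * a * rad \<nu> a x"
    unfolding bes_recurrence[OF assms(1)] using assms(2) by (simp add: rad_def rad'_def field_simps)
  finally show ?thesis unfolding e .
qed

lemma isCont_rad: "\<nu> > -1 \<Longrightarrow> isCont (rad \<nu> a) x"
  using rad_deriv DERIV_isCont by blast

section \<open>Infinitely many zeros by Sturm comparison\<close>

text \<open>Up to a constant, \<open>x powr (\<nu> + 1/2) * rad \<nu> (1/4) x\<close> is
  \<open>\<surd>x J\<^sub>\<nu>(x)\<close>, a solution of
  \<open>v'' + (1 + (1/4 - \<nu>\<^sup>2)/x\<^sup>2) v = 0\<close>. For large \<open>x\<close> the
  coefficient exceeds 1/4, the one belonging to \<open>sin (x/2)\<close>.\<close>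

lemma unbounded_zeros_rad:
  assumes "\<nu> > -1"
  shows "\<exists>x>b. rad \<nu> (1/4) x = 0"
proof (rule ccontr)
  assume no: "\<not> (\<exists>x>b. rad \<nu> (1/4) x = 0)"
  \<comment> \<open>The arch must lie beyond \<open>b\<close>, where no zeros are assumed, and
    beyond \<open>2 * \<bar>\<nu>\<bar>\<close>, where the comparison of coefficients holds. As
    \<open>l\<close> is a multiple of \<open>4 * pi\<close>, the sine is nonnegative on the
    arch.\<close>
  define k where "k = nat \<lceil>\<bar>b\<bar> + \<bar>\<nu>\<bar> + 1\<rceil>"
  define l where "l = 4 * pi * real k"
  define r where "r = l + 2 * pi"
  have "real k \<ge> \<bar>b\<bar> + \<bar>\<nu>\<bar> + 1" unfolding k_def by linarith
  moreover have "4 * pi * real k \<ge> 4 * real k" using pi_ge_two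
    by (intro mult_right_mono) auto
  ultimately have l: "l > b" "l > 2 * \<bar>\<nu>\<bar>" "l > 0" unfolding l_def by linarith+
  have lr: "l < r" by (simp add: r_def)
  define u where "u = rad \<nu> (1/4)"
  \<comment> \<open>\<open>W\<close> is the Wronskian of \<open>x powr (\<nu> + 1/2) * u x\<close> and \<open>sin (x/2)\<close>; the interval \<open>[l, r]\<close> is an
    arch of the latter, and without a zero of \<open>u\<close> on it the signs of \<open>W'\<close> and \<open>W r - W l\<close> clash.\<close>
  define W where "W = (\<lambda>x. x powr (\<nu> + 1/2) * (u x * cos (x/2) / 2 - (rad' \<nu> (1/4) x + (\<nu> + 1/2) * u x / x) * sin (x/2)))"
  have dW: "(W has_real_derivative x powr (\<nu> + 1/2) * (3/4 + (1/4 - \<nu>\<^sup>2) / x\<^sup>2) * u x * sin (x/2)) (at x)"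
    if "x > 0" for x
  proof -
    have du: "(u has_real_derivative rad' \<nu> (1/4) x) (at x)" unfolding u_def using assms by (rule rad_deriv)
    have du': "(rad' \<nu> (1/4) has_real_derivative - (2 * \<nu> + 1) / x * rad' \<nu> (1/4) x - u x) (at x)"
      using rad'_deriv[OF assms, of x "1/4"] that by (simp add: u_def)
    define s c d P where "s = sin (x/2)" and "c = cos (x/2)" and "d = rad' \<nu> (1/4) x"
      and "P = x powr (\<nu> + 1/2)"
    have P: "x powr (\<nu> - 1/2) = P / x" using that powr_diff[of x "\<nu> + 1/2" 1] by (simp add: P_def)
    have "(W has_real_derivative (\<nu> + 1/2) * x powr (\<nu> - 1/2) * (u x * c / 2 - (d + (\<nu> + 1/2) * u x / x) * s)
      + P * (d * c / 2 - u x * s / 4 - (- (2 * \<nu> + 1) / x * d - u x + (\<nu> + 1/2) * (d / x - u x / x\<^sup>2)) * s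
             - (d + (\<nu> + 1/2) * u x / x) * c / 2)) (at x)"
      unfolding W_def s_def c_def d_def P_def using that
      by (auto intro!: derivative_eq_intros du du' simp: diff_divide_distrib power2_eq_square)
        (simp add: algebra_simps add_divide_distrib diff_divide_distrib)
    also have "(\<nu> + 1/2) * x powr (\<nu> - 1/2) * (u x * c / 2 - (d + (\<nu> + 1/2) * u x / x) * s)
      + P * (d * c / 2 - u x * s / 4 - (- (2 * \<nu> + 1) / x * d - u x + (\<nu> + 1/2) * (d / x - u x / x\<^sup>2)) * s
             - (d + (\<nu> + 1/2) * u x / x) * c / 2)
      = P * ((\<nu> + 1/2) / x * (u x * c / 2 - (d + (\<nu> + 1/2) * u x / x) * s)
      + (d * c / 2 - u x * s / 4 - (- (2 * \<nu> + 1) / x * d - u x + (\<nu> + 1/2) * (d / x - u x / x\<^sup>2)) * s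
             - (d + (\<nu> + 1/2) * u x / x) * c / 2))"
      unfolding P by (simp only: distrib_left) simp
    also have "(\<nu> + 1/2) / x * (u x * c / 2 - (d + (\<nu> + 1/2) * u x / x) * s)
      + (d * c / 2 - u x * s / 4 - (- (2 * \<nu> + 1) / x * d - u x + (\<nu> + 1/2) * (d / x - u x / x\<^sup>2)) * s
             - (d + (\<nu> + 1/2) * u x / x) * c / 2)
      = (3/4 + (1/4 - \<nu>\<^sup>2) / x\<^sup>2) * u x * s"
      using that by (simp add: divide_simps) (simp add: algebra_simps power2_eq_square)
    finally show ?thesis by (simp add: P_def s_def mult.assoc)
  qed
  have q: "3/4 + (1/4 - \<nu>\<^sup>2) / x\<^sup>2 \<ge> 0" if "x \<ge> l" for x
  proof -
    have "(2 * \<bar>\<nu>\<bar>)\<^sup>2 \<le> x\<^sup>2" using that l by (intro power_mono) auto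
    hence "4 * \<nu>\<^sup>2 \<le> x\<^sup>2" by (simp add: power_mult_distrib)
    hence "4 * \<nu>\<^sup>2 \<le> 1 + 3 * x\<^sup>2" using zero_le_power2[of x] by linarith
    thus ?thesis using that l by (simp add: field_simps)
  qed
  have s: "sin (x/2) \<ge> 0" if "l \<le> x" "x \<le> r" for x
  proof -
    have "sin (x/2) = sin (x/2 - 2 * real k * pi)"
      by (simp add: sin_diff)
    also have "\<dots> \<ge> 0" using that by (intro sin_ge_zero) (auto simp: l_def r_def field_simps)
    finally show ?thesis .
  qed
  have sl: "sin (l/2) = 0" "cos (l/2) = 1" 
    using sin_2npi[of k] cos_2npi[of k] by (auto simp: l_def algebra_simps)
  have sr: "sin (r/2) = 0" "cos (r/2) = -1"
    using sl by (auto simp: r_def add_divide_distrib)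
  have nz: "u x \<noteq> 0" if "x \<ge> l" for x using no that l by (auto simp: u_def)
  have cu: "continuous_on A u" for A
    unfolding u_def using isCont_rad[OF assms] by (simp add: continuous_at_imp_continuous_on)
  \<comment> \<open>The factor \<open>\<sigma>\<close>, taken to be \<open>u l\<close>, makes
    \<open>u\<close> positive and so treats both signs at once.\<close>
  obtain \<sigma> where \<sigma>: "\<And>x. l \<le> x \<Longrightarrow> x \<le> r \<Longrightarrow> \<sigma> * u x > 0"
  proof (rule that)
    fix x assume x: "l \<le> x" "x \<le> r"
    show "u l * u x > 0"
    proof (rule ccontr)
      assume "\<not> ?thesis"
      hence "u l \<le> 0 \<and> u x \<ge> 0 \<or> u l \<ge> 0 \<and> u x \<le> 0"
        by (metis linorder_not_le mult_neg_neg mult_pos_pos order_less_imp_le)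
      hence "\<exists>y. l \<le> y \<and> y \<le> x \<and> u y = 0"
        using IVT'[of u l 0 x, OF _ _ x(1) cu] IVT2'[of u x 0 l, OF _ _ x(1) cu] by blast
      thus False using nz by auto
    qed
  qed
  have "\<sigma> * W l \<le> \<sigma> * W r"
  proof (rule DERIV_nonneg_imp_nondecreasing[of l r "\<lambda>x. \<sigma> * W x"])
    fix x assume x: "l \<le> x" "x \<le> r"
    have "((\<lambda>x. \<sigma> * W x) has_real_derivative
        \<sigma> * (x powr (\<nu> + 1/2) * (3/4 + (1/4 - \<nu>\<^sup>2) / x\<^sup>2) * u x * sin (x/2))) (at x)"
      by (rule DERIV_cmult[OF dW]) (use x l in simp)
    moreover have "x powr (\<nu> + 1/2) * (3/4 + (1/4 - \<nu>\<^sup>2) / x\<^sup>2) * (\<sigma> * u x) * sin (x/2) \<ge> 0"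
      by (intro mult_nonneg_nonneg[OF mult_nonneg_nonneg[OF mult_nonneg_nonneg]] s[OF x] q[OF x(1)]
          less_imp_le[OF \<sigma>[OF x]]) simp
    ultimately show "\<exists>y. ((\<lambda>x. \<sigma> * W x) has_real_derivative y) (at x) \<and> y \<ge> 0"
      by (auto simp: mult_ac)
  qed (use lr in simp)
  \<comment> \<open>At the end points the sine vanishes and the cosine is 1 and -1, so
    \<open>W\<close> reduces to multiples of \<open>u l\<close> and \<open>- u r\<close>.\<close>
  hence "r powr (\<nu> + 1/2) * (\<sigma> * u r) + l powr (\<nu> + 1/2) * (\<sigma> * u l) \<le> 0"
    by (simp add: W_def sl sr mult_ac)
  moreover have "r powr (\<nu> + 1/2) * (\<sigma> * u r) > 0" "l powr (\<nu> + 1/2) * (\<sigma> * u l) > 0"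
    using \<sigma>[of r] \<sigma>[of l] l lr by (auto intro!: mult_pos_pos)
  ultimately show False by linarith
qed

section \<open>Enumeration of the zeros\<close>

text \<open>Passing from any bound \<open>b\<close> to the least element above it raises the count
  by exactly one, so every positive count is attained.\<close>

lemma ex_nth_element:
  fixes Z :: "real set"
  assumes fin: "\<And>b. finite {y \<in> Z. y \<le> b}" and unb: "\<And>b. \<exists>z\<in>Z. z > b"
  shows "\<exists>z\<in>Z. card {y \<in> Z. y \<le> z} = Suc n"
proof -
  have step: "\<exists>z\<in>Z. z > b \<and> {y \<in> Z. y \<le> z} = insert z {y \<in> Z. y \<le> b}" for b
  proof -
    obtain w where w: "w \<in> Z" "w > b" using unb by blast
    \<comment> \<open>\<open>A\<close> is finite and nonempty, so its minimum is the element of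
      \<open>Z\<close> next after \<open>b\<close>.\<close>
    define A where "A = {y \<in> Z. y \<le> w \<and> y > b}"
    have A: "finite A" "A \<noteq> {}" using fin[of w] w by (auto simp: A_def intro: finite_subset[rotated])
    have "Min A \<in> A" using A by simp
    hence m: "Min A \<in> Z" "b < Min A" "Min A \<le> w" unfolding A_def by auto
    have "y = Min A" if "y \<in> Z" "y \<le> Min A" "y > b" for y
    proof -
      have "y \<in> A" using that m by (simp add: A_def)
      thus ?thesis using that Min_le[OF A(1), of y] by simp
    qed
    hence "{y \<in> Z. y \<le> Min A} = insert (Min A) {y \<in> Z. y \<le> b}"
      using m by (force simp: not_less)
    thus ?thesis using m by blast
  qed
  show ?thesis
  proof (induction n)
    case 0
    obtain z0 where z0: "z0 \<in> Z" using unb by blast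
    \<comment> \<open>Starting below all of \<open>Z\<close>, one application of \<open>step\<close>
      yields the least element.\<close>
    have "\<exists>b. {y \<in> Z. y \<le> b} = {}"
      by (rule exI[of _ "Min {y \<in> Z. y \<le> z0} - 1"])
        (use Min_le[OF fin[of z0]] Min_in[OF fin[of z0]] z0 in fastforce)
    thus ?case using step by (metis card_1_singleton_iff One_nat_def)
  next
    case (Suc n)
    then obtain b where b: "b \<in> Z" "card {y \<in> Z. y \<le> b} = Suc n" by blast
    obtain z where "z \<in> Z" "z > b" "{y \<in> Z. y \<le> z} = insert z {y \<in> Z. y \<le> b}" using step by blast
    thus ?case using b fin[of b] by (intro bexI[of _ z]) auto
  qed
qed

text \<open>Justifies the definite description: the zeros are locally finite and unbounded, which
  gives existence, and the count grows strictly from zero to zero, which gives uniqueness.\<close>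

lemma Bessel_zero:
  assumes "\<nu> > -1" "n \<ge> 1"
  shows "Bessel_zero \<nu> n > 0" "Bessel_J \<nu> (Bessel_zero \<nu> n) = 0"
    "card {y. 0 < y \<and> y \<le> Bessel_zero \<nu> n \<and> Bessel_J \<nu> y = 0} = n"
proof -
  define Z where "Z = {y. 0 < y \<and> Bessel_J \<nu> y = 0}"
  \<comment> \<open>The map \<open>x \<mapsto> x\<^sup>2/4\<close> is injective on positive numbers
    and carries these zeros to zeros of \<open>bes \<nu>\<close>.\<close>
  have fin: "finite {y \<in> Z. y \<le> b}" for b
  proof (rule finite_imageD)
    let ?f = "\<lambda>x::real. x\<^sup>2 / 4"
    show "inj_on ?f {y \<in> Z. y \<le> b}" by (auto simp: inj_on_def Z_def)
    have "?f ` {y \<in> Z. y \<le> b} \<subseteq> {t. 0 < t \<and> t \<le> b\<^sup>2 / 4 \<and> bes \<nu> t = 0}"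
      using assms(1) by (auto simp: Z_def Bessel_J_zero_iff intro!: power_mono)
    thus "finite (?f ` {y \<in> Z. y \<le> b})" using finite_zeros_bes[OF assms(1)] finite_subset by blast
  qed
  have unb: "\<exists>z\<in>Z. z > b" for b
  proof -
    obtain x where "x > max b 0" "rad \<nu> (1/4) x = 0" using unbounded_zeros_rad[OF assms(1)] by blast
    thus ?thesis using assms(1) by (intro bexI[of _ x]) (auto simp: Z_def Bessel_J_zero_iff rad_def)
  qed
  have eq: "{y. 0 < y \<and> y \<le> z \<and> Bessel_J \<nu> y = 0} = {y \<in> Z. y \<le> z}" for z by (auto simp: Z_def)
  let ?P = "\<lambda>z. 0 < z \<and> Bessel_J \<nu> z = 0 \<and> card {y. 0 < y \<and> y \<le> z \<and> Bessel_J \<nu> y = 0} = n"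
  have "\<exists>z. ?P z" using ex_nth_element[OF fin unb, of "n - 1"] assms(2) unfolding eq by (auto simp: Z_def)
  moreover have less: "card {y \<in> Z. y \<le> z} < card {y \<in> Z. y \<le> z'}" if "z' \<in> Z" "z < z'" for z z'
  proof (rule psubset_card_mono[OF fin])
    have "z' \<notin> {y \<in> Z. y \<le> z}" "z' \<in> {y \<in> Z. y \<le> z'}" using that by auto
    thus "{y \<in> Z. y \<le> z} \<subset> {y \<in> Z. y \<le> z'}" using that by force
  qed
  have "z = z'" if "?P z" "?P z'" for z z'
    using less[of z z'] less[of z' z] that unfolding eq
    by (cases z z' rule: linorder_cases) (auto simp: Z_def)
  ultimately have "?P (Bessel_zero \<nu> n)" unfolding Bessel_zero_def by (intro theI'[of ?P]) blast
  thus "Bessel_zero \<nu> n > 0" "Bessel_J \<nu> (Bessel_zero \<nu> n) = 0"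
    "card {y. 0 < y \<and> y \<le> Bessel_zero \<nu> n \<and> Bessel_J \<nu> y = 0} = n" by auto
qed

section \<open>Wronskians and their behaviour at the end points\<close>

definition wronskian :: "real \<Rightarrow> real \<Rightarrow> real \<Rightarrow> real \<Rightarrow> real" where
  "wronskian \<nu> b a x = rad' \<nu> a x * rad \<nu> b x - rad \<nu> a x * rad' \<nu> b x"

text \<open>The common form of the three systems: \<open>w\<^sub>n/u\<^sub>1\<close> times the
  square root of the weight \<open>p\<close>, so that it lives in \<open>L\<^sup>2(dx)\<close>. The
  parameter \<open>b\<close> stands for the first node.\<close>

definition wronskian_sys :: "real \<Rightarrow> real \<Rightarrow> real \<Rightarrow> real \<Rightarrow> real" where
  "wronskian_sys \<nu> b a x = x powr (\<nu> + 1/2) * wronskian \<nu> b a x / rad \<nu> b x"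

text \<open>The Wronskian with a factor \<open>x\<close> split off, still continuous at 0. That
  factor raises the exponents \<open>\<nu> + 1/2\<close> and \<open>2 * \<nu> + 1\<close>, possibly
  negative, to \<open>\<nu> + 3/2\<close> and \<open>2 * \<nu> + 2\<close>, which are
  positive.\<close>

definition wronskian_quot :: "real \<Rightarrow> real \<Rightarrow> real \<Rightarrow> real \<Rightarrow> real" where
  "wronskian_quot \<nu> b a x = 2 * b * rad (\<nu> + 1) b x * rad \<nu> a x - 2 * a * rad (\<nu> + 1) a x * rad \<nu> b x"

lemma wronskian_eq: "wronskian \<nu> b a x = x * wronskian_quot \<nu> b a x"
  by (simp add: wronskian_def wronskian_quot_def rad'_def rad_def algebra_simps)

lemma isCont_wronskian_quot: "\<nu> > -1 \<Longrightarrow> isCont (wronskian_quot \<nu> b a) x"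
  unfolding wronskian_quot_def by (intro continuous_intros isCont_rad) auto

lemma wronskian_quot_deriv:
  assumes "\<nu> > -1"
  shows "\<exists>D. (wronskian_quot \<nu> b a has_real_derivative D) (at x)"
proof -
  note d = rad_deriv[OF assms] rad_deriv[of "\<nu> + 1"]
  show ?thesis unfolding wronskian_quot_def
    by (rule exI) (rule derivative_intros d | use assms in simp)+
qed

text \<open>Dividing numerator and denominator by \<open>x - c\<close> turns both into difference
  quotients. This handles division by \<open>u\<^sub>1\<close> at its simple zero 1.\<close>

lemma quotient_tendsto_at_common_zero:
  fixes f g :: "real \<Rightarrow> real"
  assumes "(f has_real_derivative f') (at c)" "(g has_real_derivative g') (at c)"
    and "f c = 0" "g c = 0" "g' \<noteq> 0"
  shows "((\<lambda>x. f x / g x) \<longlongrightarrow> f' / g') (at c)"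
proof -
  have "((\<lambda>x. (f x / (x - c)) / (g x / (x - c))) \<longlongrightarrow> f' / g') (at c)"
    using assms by (intro tendsto_divide) (simp_all add: has_field_derivative_iff)
  moreover have "eventually (\<lambda>x. (f x / (x - c)) / (g x / (x - c)) = f x / g x) (at c)"
    by (auto simp: eventually_at_filter)
  ultimately show ?thesis using tendsto_cong by fast
qed

lemma bounded_quotient:
  fixes h :: "real \<Rightarrow> real"
  assumes c: "continuous_on {a..<b} h" and L: "(h \<longlongrightarrow> L) (at_left b)" and ab: "a < b"
  obtains M where "\<And>x. a \<le> x \<Longrightarrow> x < b \<Longrightarrow> \<bar>h x\<bar> \<le> M"
proof -
  have "eventually (\<lambda>x. dist (h x) L < 1) (at_left b)" using L by (rule tendstoD) simp
  then obtain d where d: "d < b" "\<And>x. d < x \<Longrightarrow> x < b \<Longrightarrow> dist (h x) L < 1"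
    unfolding eventually_at_left[OF ab] by metis
  have "continuous_on {a..d} h" by (rule continuous_on_subset[OF c]) (use d in auto)
  hence "bounded (h ` {a..d})" by (intro compact_imp_bounded compact_continuous_image) auto
  then obtain B where B: "\<forall>x\<in>{a..d}. \<bar>h x\<bar> \<le> B" unfolding bounded_iff by auto
  show ?thesis
  proof (rule that)
    fix x assume "a \<le> x" "x < b"
    thus "\<bar>h x\<bar> \<le> max B (\<bar>L\<bar> + 1)"
      using bspec[OF B, of x] d(2)[of x] by (cases "x \<le> d") (auto simp: dist_real_def)
  qed
qed

text \<open>This is \<open>G\<^sub>m\<^sub>n\<close> of the overview; here \<open>m\<close> and
  \<open>n\<close> are the real parameters of \<open>rad\<close>, not indices.\<close>

definition antideriv :: "real \<Rightarrow> real \<Rightarrow> real \<Rightarrow> real \<Rightarrow> real \<Rightarrow> real" where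
  "antideriv \<nu> b m n x = x powr (2 * \<nu> + 1) * wronskian \<nu> b m x * (rad \<nu> n x / rad \<nu> b x)"

text \<open>Lagrange's identity: the derivative of the weight cancels the first-order terms of the
  differential equation, and only the difference of the eigenvalues remains.\<close>

lemma wronskian_deriv:
  assumes "\<nu> > -1" "x > 0"
  shows "((\<lambda>x. x powr (2 * \<nu> + 1) * wronskian \<nu> b a x) has_real_derivative
    - 4 * (a - b) * x powr (2 * \<nu> + 1) * rad \<nu> a x * rad \<nu> b x) (at x)"
proof -
  note d = rad_deriv[OF assms(1)] rad'_deriv[OF assms(1)]
  define P where "P = x powr (2 * \<nu> + 1)"
  have P: "x powr (2 * \<nu>) = P / x" using assms powr_diff[of x "2*\<nu>+1" 1] by (simp add: P_def)
  define ua ub va vb where "ua = rad \<nu> a x" and "ub = rad \<nu> b x" and "va = rad' \<nu> a x" and "vb = rad' \<nu> b x"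
  define va' vb' where "va' = - (2 * \<nu> + 1) / x * va - 4 * a * ua" and "vb' = - (2 * \<nu> + 1) / x * vb - 4 * b * ub"
  have d': "(rad' \<nu> a has_real_derivative va') (at x)" "(rad' \<nu> b has_real_derivative vb') (at x)"
    "(rad \<nu> a has_real_derivative va) (at x)" "(rad \<nu> b has_real_derivative vb) (at x)"
    using d assms by (auto simp: ua_def ub_def va_def vb_def va'_def vb'_def)
  have "((\<lambda>x. wronskian \<nu> b a x) has_real_derivative va' * ub - ua * vb') (at x)"
    unfolding wronskian_def
    by (rule DERIV_cong[OF DERIV_diff[OF DERIV_mult[OF d'(1,4)] DERIV_mult[OF d'(3,2)]]])
      (simp add: ua_def ub_def va_def vb_def)
  moreover have "((\<lambda>x. x powr (2 * \<nu> + 1)) has_real_derivative (2 * \<nu> + 1) * (P / x)) (at x)"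
    using assms P by (auto intro!: derivative_eq_intros)
  ultimately have "((\<lambda>x. x powr (2 * \<nu> + 1) * wronskian \<nu> b a x) has_real_derivative
     (2 * \<nu> + 1) * (P / x) * wronskian \<nu> b a x + (va' * ub - ua * vb') * P) (at x)"
    unfolding P_def using DERIV_mult by blast
  also have "(2 * \<nu> + 1) * (P / x) * wronskian \<nu> b a x + (va' * ub - ua * vb') * P
     = - 4 * (a - b) * P * ua * ub"
    unfolding wronskian_def va'_def vb'_def ua_def[symmetric] ub_def[symmetric] va_def[symmetric] vb_def[symmetric]
    using assms(2) by (simp add: field_simps)
  finally show ?thesis by (simp add: P_def ua_def ub_def)
qed

text \<open>Product rule for \<open>p w\<^sub>m\<close> and \<open>u\<^sub>n/u\<^sub>b\<close>: the
  derivative of the second factor is \<open>w\<^sub>n/u\<^sub>b\<^sup>2\<close>, and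
  \<open>p\<close> is the square of \<open>x powr (\<nu> + 1/2)\<close>.\<close>

lemma antideriv_deriv:
  assumes "\<nu> > -1" "x > 0" "rad \<nu> b x \<noteq> 0"
  shows "(antideriv \<nu> b m n has_real_derivative wronskian_sys \<nu> b m x * wronskian_sys \<nu> b n x
      - 4 * (m - b) * (x powr (2 * \<nu> + 1) * rad \<nu> m x * rad \<nu> n x)) (at x)"
proof -
  note d = rad_deriv[OF assms(1)]
  have q: "((\<lambda>x. rad \<nu> n x / rad \<nu> b x) has_real_derivative wronskian \<nu> b n x / (rad \<nu> b x)\<^sup>2) (at x)"
    using DERIV_divide[OF d d assms(3)] by (simp add: wronskian_def power2_eq_square)
  define Q where "Q = x powr (\<nu> + 1/2)"
  have P: "x powr (2 * \<nu> + 1) = Q * Q"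
    by (simp add: Q_def flip: powr_add)
  have "(antideriv \<nu> b m n has_real_derivative
      - 4 * (m - b) * x powr (2 * \<nu> + 1) * rad \<nu> m x * rad \<nu> b x * (rad \<nu> n x / rad \<nu> b x)
      + wronskian \<nu> b n x / (rad \<nu> b x)\<^sup>2 * (x powr (2 * \<nu> + 1) * wronskian \<nu> b m x)) (at x)"
    unfolding antideriv_def by (rule DERIV_mult[OF wronskian_deriv[OF assms(1,2)] q])
  thus ?thesis
    unfolding wronskian_sys_def P Q_def[symmetric]
    by (rule DERIV_cong) (use assms(3) in \<open>simp add: power2_eq_square field_simps\<close>)
qed

lemma wronskian_sys_eq:
  assumes "x > 0"
  shows "wronskian_sys \<nu> b a x = x powr (\<nu> + 3/2) * (wronskian_quot \<nu> b a x / rad \<nu> b x)"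
proof -
  have "\<nu> + 3/2 = \<nu> + 1/2 + 1" by simp
  hence "x powr (\<nu> + 3/2) = x powr (\<nu> + 1/2) * x" using assms by (simp only: powr_add powr_one)
  thus ?thesis by (simp add: wronskian_sys_def wronskian_eq)
qed

lemma antideriv_eq:
  assumes "x > 0"
  shows "antideriv \<nu> b m n x = x powr (2 * \<nu> + 2) * wronskian_quot \<nu> b m x * (rad \<nu> n x / rad \<nu> b x)"
proof -
  have "2 * \<nu> + 2 = 2 * \<nu> + 1 + 1" by simp
  hence "x powr (2 * \<nu> + 2) = x powr (2 * \<nu> + 1) * x" using assms by (simp only: powr_add powr_one)
  thus ?thesis by (simp add: antideriv_def wronskian_eq)
qed

section \<open>Integration over the unit interval\<close>

lemma space_dx [simp]: "space dx_measure = {0<..<1}"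
  by (simp add: dx_measure_def space_restrict_space)

lemma borel_measurable_dx: "continuous_on {0<..<1} f \<Longrightarrow> (f :: real \<Rightarrow> real) \<in> borel_measurable dx_measure"
  using borel_measurable_continuous_on_restrict[of "{0<..<1}" f]
  unfolding dx_measure_def by (simp cong: measurable_cong_sets sets_restrict_space_cong)

lemma finite_measure_dx: "finite_measure dx_measure"
  by (rule finite_measureI) (simp add: dx_measure_def emeasure_restrict_space space_restrict_space)

lemma integrable_dx_bounded:
  assumes "continuous_on {0<..<1} (f :: real \<Rightarrow> real)" "\<And>x. 0 < x \<Longrightarrow> x < 1 \<Longrightarrow> \<bar>f x\<bar> \<le> M"
  shows "integrable dx_measure f"
  using assms by (intro finite_measure.integrable_const_bound[OF finite_measure_dx, of _ M] borel_measurable_dx)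
    (auto intro!: AE_I2)

text \<open>At the end points only one-sided limits of \<open>F\<close> are required, since the
  antiderivatives in question are quotients whose denominator vanishes at 1.\<close>

lemma integral_dx_FTC:
  fixes f F :: "real \<Rightarrow> real"
  assumes c: "continuous_on {0<..<1} f" and M: "\<And>x. 0 < x \<Longrightarrow> x < 1 \<Longrightarrow> \<bar>f x\<bar> \<le> M"
    and F: "\<And>x. 0 < x \<Longrightarrow> x < 1 \<Longrightarrow> (F has_real_derivative f x) (at x)"
    and A: "(F \<longlongrightarrow> A) (at_right 0)" and B: "(F \<longlongrightarrow> B) (at_left 1)"
  shows "(\<integral>x. f x \<partial>dx_measure) = B - A"
proof -
  have i: "set_integrable lborel {0<..<1} f"
  proof -
    have "integrable dx_measure f" by (rule integrable_dx_bounded[OF c]) (rule M)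
    thus ?thesis by (simp add: dx_measure_def set_integrable_def integrable_restrict_space)
  qed
  have e: "einterval 0 1 = {0<..<1::real}" by (auto simp: einterval_def)
  have "(LBINT x=0..1. f x) = B - A"
  proof (rule interval_integral_FTC_integrable)
    show "(F has_vector_derivative f x) (at x)" if "0 < ereal x" "ereal x < 1" for x
      using F[of x] that by (simp add: has_real_derivative_iff_has_vector_derivative)
    show "isCont f x" if "0 < ereal x" "ereal x < 1" for x
      using c that by (simp add: continuous_on_eq_continuous_at)
    show "((F \<circ> real_of_ereal) \<longlongrightarrow> A) (at_right 0)" 
      using A by (simp add: zero_ereal_def ereal_tendsto_simps)
    show "((F \<circ> real_of_ereal) \<longlongrightarrow> B) (at_left 1)"
      using B by (simp add: one_ereal_def ereal_tendsto_simps)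
  qed (use i e in auto)
  moreover have "(LBINT x=0..1. f x) = (\<integral>x. f x \<partial>dx_measure)"
    unfolding dx_measure_def interval_lebesgue_integral_def e set_lebesgue_integral_def
    by (subst integral_restrict_space) auto
  ultimately show ?thesis by simp
qed

section \<open>Orthogonality of the common form, and its transfer to weighted spaces\<close>

text \<open>Division by \<open>rad \<nu> b\<close> is critical only at 1, where the numerators
  vanish too. The functions are therefore bounded, which gives square integrability and admits the
  fundamental theorem of calculus.\<close>

lemma orthogonal_wronskian_sys:
  assumes nu: "\<nu> > -1" and b: "b > 0" "rad \<nu> b 1 = 0" "\<And>x. 0 \<le> x \<Longrightarrow> x < 1 \<Longrightarrow> rad \<nu> b x \<noteq> 0"
    and inj: "inj_on a I" and zero: "\<And>n. n \<in> I \<Longrightarrow> rad \<nu> (a n) 1 = 0"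
  shows "orthogonal_system_L2 dx_measure I (\<lambda>n. wronskian_sys \<nu> b (a n))"
proof -
  have "rad' \<nu> b 1 \<noteq> 0"
    using bes_simple_zero[OF nu b(1)] b(1,2) by (simp add: rad_def rad'_def)
  hence lim: "\<exists>L. ((\<lambda>x. f x / rad \<nu> b x) \<longlongrightarrow> L) (at_left 1)"
    if "f 1 = 0" "(f has_real_derivative D) (at 1)" for f D
    using quotient_tendsto_at_common_zero[OF that(2) rad_deriv[OF nu] that(1) b(2)]
    by (auto simp: filterlim_at_split)
  have cr: "continuous_on A (rad \<nu> c)" for A c
    using isCont_rad[OF nu] by (simp add: continuous_at_imp_continuous_on)
  have cw: "continuous_on A (wronskian_quot \<nu> b c)" for A c
    using isCont_wronskian_quot[OF nu] by (simp add: continuous_at_imp_continuous_on)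
  have cs: "continuous_on {0<..<1} (wronskian_sys \<nu> b c)" for c
  proof -
    have "continuous_on {0<..<1} (\<lambda>x. x powr (\<nu> + 3/2) * (wronskian_quot \<nu> b c x / rad \<nu> b x))"
      using b(3) by (intro continuous_intros cr cw) auto
    thus ?thesis by (rule continuous_on_cong[THEN iffD2, rotated -1]) (auto simp: wronskian_sys_eq)
  qed
  have bound: "\<exists>M. \<forall>x\<in>{0<..<1}. \<bar>wronskian_sys \<nu> b (a n) x\<bar> \<le> M" if n: "n \<in> I" for n
  proof -
    have "wronskian_quot \<nu> b (a n) 1 = 0" using zero[OF n] b(2) by (simp add: wronskian_quot_def)
    then obtain L where L: "((\<lambda>x. wronskian_quot \<nu> b (a n) x / rad \<nu> b x) \<longlongrightarrow> L) (at_left 1)"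
      using lim wronskian_quot_deriv[OF nu] by blast
    have "continuous_on {0..<1} (\<lambda>x. wronskian_quot \<nu> b (a n) x / rad \<nu> b x)"
      using b(3) by (intro continuous_intros cr cw) auto
    then obtain M where M: "\<And>x. 0 \<le> x \<Longrightarrow> x < 1 \<Longrightarrow> \<bar>wronskian_quot \<nu> b (a n) x / rad \<nu> b x\<bar> \<le> M"
      using bounded_quotient[OF _ L zero_less_one] by blast
    show ?thesis
    proof (intro exI[of _ M] ballI)
      fix x :: real assume x: "x \<in> {0<..<1}"
      \<comment> \<open>The exponent is positive, so this factor does not spoil the bound near
        0.\<close>
      have "x powr (\<nu> + 3/2) \<le> 1" using x nu by (intro powr_le1) auto
      hence "x powr (\<nu> + 3/2) * \<bar>wronskian_quot \<nu> b (a n) x / rad \<nu> b x\<bar> \<le> 1 * M"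
        using M[of x] x by (intro mult_mono) auto
      thus "\<bar>wronskian_sys \<nu> b (a n) x\<bar> \<le> M" using x by (simp add: wronskian_sys_eq abs_mult)
    qed
  qed
  have pbound: "\<exists>M. \<forall>x. 0 < x \<longrightarrow> x < 1 \<longrightarrow> \<bar>wronskian_sys \<nu> b (a m) x * wronskian_sys \<nu> b (a n) x\<bar> \<le> M"
    if mn: "m \<in> I" "n \<in> I" for m n
  proof -
    obtain M N where "\<forall>x\<in>{0<..<1}. \<bar>wronskian_sys \<nu> b (a m) x\<bar> \<le> M" "\<forall>x\<in>{0<..<1}. \<bar>wronskian_sys \<nu> b (a n) x\<bar> \<le> N"
      using bound[OF mn(1)] bound[OF mn(2)] by blast
    thus ?thesis by (intro exI[of _ "M * N"]) (auto simp: abs_mult intro!: mult_mono order_trans[OF abs_ge_zero])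
  qed
  have cp: "continuous_on {0<..<1} (\<lambda>x. wronskian_sys \<nu> b m x * wronskian_sys \<nu> b n x)" for m n
    by (intro continuous_intros cs)
  have lim0: "(antideriv \<nu> b m n \<longlongrightarrow> 0) (at_right 0)" for m n
  proof -
    have "((\<lambda>x. x powr (2 * \<nu> + 2)) \<longlongrightarrow> 0 powr (2 * \<nu> + 2)) (at_right (0::real))"
      using nu by (intro tendsto_powr') (auto intro!: tendsto_intros simp: eventually_at_filter)
    moreover have "(rad \<nu> c \<longlongrightarrow> rad \<nu> c 0) (at_right 0)" "(wronskian_quot \<nu> b c \<longlongrightarrow> wronskian_quot \<nu> b c 0) (at_right 0)" for c
      using isCont_rad[OF nu, of 0 c] isCont_wronskian_quot[OF nu, of 0 b c] by (auto simp: isCont_def filterlim_at_split)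
    ultimately have "((\<lambda>x. x powr (2 * \<nu> + 2) * wronskian_quot \<nu> b m x * (rad \<nu> n x / rad \<nu> b x))
       \<longlongrightarrow> 0 powr (2 * \<nu> + 2) * wronskian_quot \<nu> b m 0 * (rad \<nu> n 0 / rad \<nu> b 0)) (at_right 0)"
      using b(3)[of 0] by (intro tendsto_mult tendsto_divide) auto
    moreover have "eventually (\<lambda>x. x powr (2 * \<nu> + 2) * wronskian_quot \<nu> b m x * (rad \<nu> n x / rad \<nu> b x)
        = antideriv \<nu> b m n x) (at_right 0)"
      by (auto simp: eventually_at_filter antideriv_eq)
    ultimately show ?thesis using tendsto_cong by fastforce
  qed
  \<comment> \<open>The weighted Wronskian tends to 0, as both functions in it vanish at 1, while
    the remaining quotient has a finite limit.\<close>
  have lim1: "(antideriv \<nu> b (a m) (a n) \<longlongrightarrow> 0) (at_left 1)" if mn: "m \<in> I" "n \<in> I" for m n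
  proof -
    obtain L where L: "((\<lambda>x. rad \<nu> (a n) x / rad \<nu> b x) \<longlongrightarrow> L) (at_left 1)"
      using lim zero[OF mn(2)] rad_deriv[OF nu] by blast
    have "isCont (rad' \<nu> c) 1" for c by (rule DERIV_isCont[OF rad'_deriv[OF nu]]) simp
    hence "isCont (\<lambda>x. x powr (2 * \<nu> + 1) * wronskian \<nu> b (a m) x) 1"
      unfolding wronskian_def by (intro continuous_intros isCont_rad nu) auto
    hence "((\<lambda>x. x powr (2 * \<nu> + 1) * wronskian \<nu> b (a m) x) \<longlongrightarrow> 0) (at_left 1)"
      using zero[OF mn(1)] b(2) by (auto simp: isCont_def filterlim_at_split wronskian_def)
    from tendsto_mult[OF this L] show ?thesis by (simp add: antideriv_def[abs_def])
  qed
  have "(\<integral>x. wronskian_sys \<nu> b (a m) x * wronskian_sys \<nu> b (a n) x \<partial>dx_measure) = 0"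
    if mn: "m \<in> I" "n \<in> I" "m \<noteq> n" for m n
  proof -
    have ne: "a n - a m \<noteq> 0" using inj mn by (auto dest: inj_onD)
    \<comment> \<open>In this combination the terms with
      \<open>rad \<nu> (a m) x * rad \<nu> (a n) x\<close> cancel; the products of the system remain
      with total factor \<open>a n - a m\<close>, which the division removes.\<close>
    define F where "F = (\<lambda>x. ((a n - b) * antideriv \<nu> b (a m) (a n) x - (a m - b) * antideriv \<nu> b (a n) (a m) x) / (a n - a m))"
    obtain M where M: "\<And>x. 0 < x \<Longrightarrow> x < 1 \<Longrightarrow> \<bar>wronskian_sys \<nu> b (a m) x * wronskian_sys \<nu> b (a n) x\<bar> \<le> M"
      using pbound mn by blast
    have dF: "(F has_real_derivative wronskian_sys \<nu> b (a m) x * wronskian_sys \<nu> b (a n) x) (at x)" if "0 < x" "x < 1" for x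
    proof -
      note D = antideriv_deriv[OF nu that(1) b(3)]
      show ?thesis unfolding F_def
        by (rule DERIV_cong[OF DERIV_cdivide[OF DERIV_diff[OF DERIV_cmult[OF D] DERIV_cmult[OF D]]]])
          (use that ne in \<open>simp_all add: field_simps\<close>)
    qed
    have limF: "(F \<longlongrightarrow> ((a n - b) * 0 - (a m - b) * 0) / (a n - a m)) (at_right 0)"
      "(F \<longlongrightarrow> ((a n - b) * 0 - (a m - b) * 0) / (a n - a m)) (at_left 1)"
      unfolding F_def using mn ne by (intro tendsto_intros lim0 lim1; simp)+
    from integral_dx_FTC[OF cp _ _ limF] M dF show ?thesis by auto
  qed
  moreover have "in_L2 dx_measure (wronskian_sys \<nu> b (a n))" if n: "n \<in> I" for n
  proof -
    obtain M where "\<And>x. 0 < x \<Longrightarrow> x < 1 \<Longrightarrow> \<bar>wronskian_sys \<nu> b (a n) x * wronskian_sys \<nu> b (a n) x\<bar> \<le> M"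
      using pbound n by blast
    hence "integrable dx_measure (\<lambda>x. wronskian_sys \<nu> b (a n) x * wronskian_sys \<nu> b (a n) x)"
      by (rule integrable_dx_bounded[OF cp])
    thus ?thesis unfolding in_L2_def by (auto simp: power2_eq_square intro: borel_measurable_dx cs)
  qed
  ultimately show ?thesis unfolding orthogonal_system_L2_def by blast
qed

text \<open>Multiplication by \<open>r\<close> preserves inner products from the space with density
  \<open>r\<^sup>2\<close> to that of \<open>M\<close>, and it sends \<open>F n\<close> to a
  multiple of \<open>S n\<close>. Measurability of \<open>F n\<close> comes from dividing by
  \<open>r\<close>.\<close>

lemma orthogonal_system_density:
  assumes S: "orthogonal_system_L2 M I S" and r: "r \<in> borel_measurable M"
    and eq: "\<And>n x. n \<in> I \<Longrightarrow> x \<in> space M \<Longrightarrow> r x * F n x = K n * S n x"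
    and \<rho>: "\<And>x. x \<in> space M \<Longrightarrow> \<rho> x = (r x)\<^sup>2" and nz: "\<And>x. x \<in> space M \<Longrightarrow> r x \<noteq> 0"
  shows "orthogonal_system_L2 (density M (\<lambda>x. ennreal (\<rho> x))) I F"
proof -
  have Sm: "S n \<in> borel_measurable M" "integrable M (\<lambda>x. (S n x)\<^sup>2)" if "n \<in> I" for n
    using S that by (auto simp: orthogonal_system_L2_def in_L2_def)
  have [measurable]: "\<rho> \<in> borel_measurable M"
    using r by (subst measurable_cong[OF \<rho>]) simp_all
  have Fm [measurable]: "F n \<in> borel_measurable M" if "n \<in> I" for n
  proof -
    have "F n x = K n * S n x / r x" if "x \<in> space M" for x
      using eq[OF \<open>n \<in> I\<close> that] nz[OF that] by (simp add: field_simps)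
    moreover have "(\<lambda>x. K n * S n x / r x) \<in> borel_measurable M" using r Sm(1)[OF that] by simp
    ultimately show ?thesis by (rule measurable_cong[THEN iffD2])
  qed
  have pos: "AE x in M. 0 \<le> \<rho> x" by (rule AE_I2) (simp add: \<rho>)
  have prod: "\<rho> x * (F m x * F n x) = K m * K n * (S m x * S n x)" if "x \<in> space M" "m \<in> I" "n \<in> I" for m n x
  proof -
    have "\<rho> x * (F m x * F n x) = (r x * F m x) * (r x * F n x)"
      using \<rho> that by (simp add: power2_eq_square)
    thus ?thesis using eq that by simp
  qed
  have "in_L2 (density M (\<lambda>x. ennreal (\<rho> x))) (F n)" if n: "n \<in> I" for n
  proof -
    have "integrable M (\<lambda>x. K n * K n * (S n x * S n x))"
      using Sm(2)[OF n] by (simp add: power2_eq_square)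
    hence "integrable M (\<lambda>x. \<rho> x *\<^sub>R (F n x)\<^sup>2)"
      by (rule Bochner_Integration.integrable_cong[THEN iffD2, rotated -1])
        (simp_all add: prod[OF _ n n] power2_eq_square)
    thus ?thesis unfolding in_L2_def using Fm[OF n] pos
      by (subst integrable_density) auto
  qed
  moreover have "(\<integral>x. F m x * F n x \<partial>density M (\<lambda>x. ennreal (\<rho> x))) = 0"
    if mn: "m \<in> I" "n \<in> I" "m \<noteq> n" for m n
  proof -
    have "(\<integral>x. F m x * F n x \<partial>density M (\<lambda>x. ennreal (\<rho> x))) = (\<integral>x. \<rho> x *\<^sub>R (F m x * F n x) \<partial>M)"
      using Fm[OF mn(1)] Fm[OF mn(2)] pos by (intro integral_density) auto
    also have "\<dots> = (\<integral>x. K m * K n * (S m x * S n x) \<partial>M)"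
      by (intro Bochner_Integration.integral_cong refl) (simp add: prod mn)
    also have "\<dots> = 0" using S mn by (simp add: orthogonal_system_L2_def)
    finally show ?thesis .
  qed
  ultimately show ?thesis unfolding orthogonal_system_L2_def by blast
qed

section \<open>Translation back to the Bessel systems\<close>

definition Bessel_node :: "real \<Rightarrow> nat \<Rightarrow> real" where
  "Bessel_node \<nu> n = (Bessel_zero \<nu> n)\<^sup>2 / 4"

definition phi_const :: "real \<Rightarrow> nat \<Rightarrow> real" where
  "phi_const \<nu> n = sqrt 2 / \<bar>Bessel_J (\<nu> + 1) (Bessel_zero \<nu> n)\<bar> * (Bessel_zero \<nu> n / 2) powr \<nu>"

context
  fixes \<nu> :: real
  assumes nu: "\<nu> > -1"
begin

lemma node_pos: "n \<ge> 1 \<Longrightarrow> Bessel_node \<nu> n > 0"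
  using Bessel_zero(1)[OF nu, of n] by (simp add: Bessel_node_def)

lemma rad_node: "n \<ge> 1 \<Longrightarrow> rad \<nu> (Bessel_node \<nu> n) 1 = 0"
  using Bessel_zero(1,2)[OF nu, of n] by (simp add: Bessel_node_def rad_def Bessel_J_zero_iff[OF nu])

lemma inj_node: "inj_on (Bessel_node \<nu>) {2..}"
proof (rule inj_onI)
  fix m n :: nat assume mn: "m \<in> {2..}" "n \<in> {2..}" "Bessel_node \<nu> m = Bessel_node \<nu> n"
  hence "Bessel_zero \<nu> m = Bessel_zero \<nu> n"
    using Bessel_zero(1)[OF nu, of m] Bessel_zero(1)[OF nu, of n]
    by (simp add: Bessel_node_def)
  moreover have "n \<ge> 1" "m \<ge> 1" using mn by auto
  ultimately show "m = n" using Bessel_zero(3)[OF nu] by metis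
qed

text \<open>A zero at \<open>0 < x < 1\<close> would give a second zero of the Bessel function in
  \<open>(0, l]\<close> besides \<open>l\<close>, against the count 1; at 0 the value is
  positive.\<close>

lemma rad_node_1_nz:
  assumes "0 \<le> x" "x < 1"
  shows "rad \<nu> (Bessel_node \<nu> 1) x \<noteq> 0"
proof (cases "x = 0")
  case True
  thus ?thesis using bes_0[OF nu] by (simp add: rad_def)
next
  case False
  define l where "l = Bessel_zero \<nu> 1"
  have l: "l > 0" "Bessel_J \<nu> l = 0" "card {y. 0 < y \<and> y \<le> l \<and> Bessel_J \<nu> y = 0} = 1"
    using Bessel_zero[OF nu, of 1] by (auto simp: l_def)
  obtain z where z: "{y. 0 < y \<and> y \<le> l \<and> Bessel_J \<nu> y = 0} = {z}" using l(3) card_1_singletonE by blast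
  have x: "0 < l * x" "l * x < l" using assms False l by auto
  have "Bessel_J \<nu> (l * x) \<noteq> 0"
  proof
    assume "Bessel_J \<nu> (l * x) = 0"
    hence "l * x \<in> {z}" "l \<in> {z}" unfolding z[symmetric] using x l by auto
    thus False using x by simp
  qed
  moreover have node: "Bessel_node \<nu> 1 * x\<^sup>2 = (l * x)\<^sup>2 / 4"
    by (simp add: Bessel_node_def l_def power_mult_distrib)
  ultimately show ?thesis using Bessel_J_zero_iff[OF nu x(1)] unfolding rad_def node by simp
qed

text \<open>By simplicity of the zeros, the normalising denominator does not vanish. For
  \<open>n = 1\<close> this permits division by \<open>phi \<nu> 1\<close>.\<close>

lemma phi_const_nz:
  assumes "n \<ge> 1"
  shows "phi_const \<nu> n \<noteq> 0"
proof -
  have "bes (\<nu> + 1) (Bessel_node \<nu> n) \<noteq> 0"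
    using bes_simple_zero[OF nu node_pos[OF assms]] rad_node[OF assms] by (simp add: rad_def)
  hence "Bessel_J (\<nu> + 1) (Bessel_zero \<nu> n) \<noteq> 0"
    using Bessel_zero(1)[OF nu assms] Bessel_J_eq[of "\<nu> + 1"] nu by (simp add: Bessel_node_def)
  thus ?thesis using Bessel_zero(1)[OF nu assms] by (simp add: phi_const_def)
qed

lemma phi_eq:
  assumes "n \<ge> 1" "x > 0"
  shows "phi \<nu> n x = phi_const \<nu> n * rad \<nu> (Bessel_node \<nu> n) x"
proof -
  have l: "Bessel_zero \<nu> n > 0" by (rule Bessel_zero(1)[OF nu assms(1)])
  have "Bessel_zero \<nu> n * x / 2 = (Bessel_zero \<nu> n / 2) * x" by simp
  hence "Bessel_J \<nu> (Bessel_zero \<nu> n * x)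
      = (Bessel_zero \<nu> n / 2) powr \<nu> * x powr \<nu> * rad \<nu> (Bessel_node \<nu> n) x"
    using l assms(2) Bessel_J_eq[OF nu, of "Bessel_zero \<nu> n * x"]
    by (simp only: powr_mult) (simp add: rad_def Bessel_node_def power_mult_distrib)
  thus ?thesis using assms(2) by (simp add: phi_def phi_const_def powr_minus)
qed

text \<open>\<open>R_fun\<close> is minus the logarithmic derivative of \<open>u\<^sub>1\<close>;
  hence \<open>u' + R u\<close> is the Wronskian of \<open>u\<close> and \<open>u\<^sub>1\<close>
  divided by \<open>u\<^sub>1\<close>.\<close>

lemma R_fun_eq:
  assumes "x > 0"
  shows "R_fun \<nu> x = - rad' \<nu> (Bessel_node \<nu> 1) x / rad \<nu> (Bessel_node \<nu> 1) x"
proof -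
  define l where "l = Bessel_zero \<nu> 1"
  have l: "l > 0" unfolding l_def by (rule Bessel_zero(1)[OF nu]) simp
  define t where "t = (l * x)\<^sup>2 / 4"
  have t: "Bessel_node \<nu> 1 * x\<^sup>2 = t" by (simp add: t_def Bessel_node_def l_def power_mult_distrib)
  have "R_fun \<nu> x = l * ((l * x / 2) powr (\<nu> + 1) * bes (\<nu> + 1) t) / ((l * x / 2) powr \<nu> * bes \<nu> t)"
    unfolding R_fun_def l_def[symmetric] t_def
    using nu l assms by (simp add: Bessel_J_eq)
  also have "(l * x / 2) powr (\<nu> + 1) = (l * x / 2) powr \<nu> * (l * x / 2)"
    using l assms by (simp add: powr_add)
  also have "l * ((l * x / 2) powr \<nu> * (l * x / 2) * bes (\<nu> + 1) t) / ((l * x / 2) powr \<nu> * bes \<nu> t)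
     = l * (l * x / 2) * bes (\<nu> + 1) t / bes \<nu> t"
    using l assms by simp
  moreover have node: "Bessel_node \<nu> 1 = l\<^sup>2 / 4" by (simp add: Bessel_node_def l_def)
  ultimately show ?thesis unfolding rad_def rad'_def t unfolding node by (simp add: power2_eq_square)
qed

lemma phi_deriv:
  assumes "n \<ge> 1" "x > 0"
  shows "(phi \<nu> n has_real_derivative phi_const \<nu> n * rad' \<nu> (Bessel_node \<nu> n) x) (at x)"
  by (rule has_field_derivative_transform_within_open[OF DERIV_cmult[OF rad_deriv[OF nu]], of "{0<..}"])
    (use assms in \<open>simp_all add: phi_eq\<close>)

lemma delta_phi:
  assumes "n \<ge> 1" "0 < x" "x < 1"
  shows "x powr (\<nu> + 1/2) * delta_op \<nu> (phi \<nu> n) x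
    = phi_const \<nu> n * wronskian_sys \<nu> (Bessel_node \<nu> 1) (Bessel_node \<nu> n) x"
  using assms rad_node_1_nz[of x]
  by (simp add: delta_op_def DERIV_imp_deriv[OF phi_deriv] R_fun_eq phi_eq wronskian_sys_def wronskian_def field_simps)

text \<open>Differentiating the power in \<open>psi\<close> produces exactly the term that
  \<open>D_op\<close> subtracts, which leaves the power times
  \<open>delta_op \<nu> (phi \<nu> n)\<close>.\<close>

lemma D_psi:
  assumes "n \<ge> 1" "0 < x" "x < 1"
  shows "D_op \<nu> (psi \<nu> n) x = phi_const \<nu> n * wronskian_sys \<nu> (Bessel_node \<nu> 1) (Bessel_node \<nu> n) x"
proof -
  have "((\<lambda>x. x powr (\<nu> + 1/2)) has_real_derivative (\<nu> + 1/2) * (x powr (\<nu> + 1/2) / x)) (at x)"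
    using assms powr_diff[of x "\<nu> + 1/2" 1] by (auto intro!: derivative_eq_intros)
  from DERIV_mult[OF this phi_deriv[OF assms(1,2)]]
  have "deriv (psi \<nu> n) x = (\<nu> + 1/2) / x * psi \<nu> n x + x powr (\<nu> + 1/2) * deriv (phi \<nu> n) x"
    using assms by (simp add: psi_def[abs_def] DERIV_imp_deriv DERIV_imp_deriv[OF phi_deriv])
  hence "D_op \<nu> (psi \<nu> n) x = x powr (\<nu> + 1/2) * delta_op \<nu> (phi \<nu> n) x"
    by (simp add: D_op_def delta_op_def psi_def algebra_simps)
  thus ?thesis using delta_phi[OF assms] by simp
qed

text \<open>The quotient rule yields a Wronskian over the square of \<open>phi \<nu> 1\<close>; the
  prefactor cancels one power and the constant of \<open>phi \<nu> 1\<close>.\<close>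

lemma d_varphi:
  assumes "n \<ge> 1" "0 < x" "x < 1"
  shows "x powr (\<nu> + 1/2) * phi \<nu> 1 x * d_op \<nu> (varphi \<nu> n) x
    = phi_const \<nu> n * wronskian_sys \<nu> (Bessel_node \<nu> 1) (Bessel_node \<nu> n) x"
proof -
  have "phi \<nu> 1 x \<noteq> 0" using assms rad_node_1_nz[of x] phi_const_nz[of 1] by (simp add: phi_eq)
  from DERIV_divide[OF phi_deriv[OF assms(1,2)] phi_deriv[OF le_refl assms(2)] this]
  show ?thesis using assms rad_node_1_nz[of x] phi_const_nz[of 1]
    by (simp add: d_op_def varphi_def[abs_def] DERIV_imp_deriv phi_eq wronskian_sys_def wronskian_def field_simps)
qed

end

theorem proposition5p3:
  fixes \<nu> :: real
  assumes "\<nu> > -1"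
  shows "orthogonal_system_L2 (eta_measure \<nu>) {2..} (\<lambda>n. d_op \<nu> (varphi \<nu> n))
       \<and> orthogonal_system_L2 (mu_measure \<nu>) {2..} (\<lambda>n. delta_op \<nu> (phi \<nu> n))
       \<and> orthogonal_system_L2 dx_measure {2..} (\<lambda>n. D_op \<nu> (psi \<nu> n))"
proof -
  have orth: "orthogonal_system_L2 dx_measure {2..} (\<lambda>n. wronskian_sys \<nu> (Bessel_node \<nu> 1) (Bessel_node \<nu> n))"
    by (rule orthogonal_wronskian_sys)
      (use assms node_pos rad_node rad_node_1_nz inj_node in auto)
  have P: "x powr (2 * \<nu> + 1) = (x powr (\<nu> + 1/2))\<^sup>2" if "x > 0" for x :: real
    by (simp add: power2_eq_square flip: powr_add)
  have pm: "(\<lambda>x. x powr (\<nu> + 1/2)) \<in> borel_measurable dx_measure"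
    by (intro borel_measurable_dx continuous_intros) auto
  have "phi \<nu> 1 \<in> borel_measurable dx_measure"
    using phi_deriv[OF assms le_refl] by (intro borel_measurable_dx DERIV_continuous_on) (auto intro: has_field_derivative_at_within)
  hence "(\<lambda>x. x powr (\<nu> + 1/2) * phi \<nu> 1 x) \<in> borel_measurable dx_measure"
    using pm by simp
  hence "orthogonal_system_L2 (eta_measure \<nu>) {2..} (\<lambda>n. d_op \<nu> (varphi \<nu> n))"
    unfolding eta_measure_def
  proof (rule orthogonal_system_density[OF orth])
    fix n :: nat and x :: real assume "n \<in> {2..}" "x \<in> space dx_measure"
    thus "x powr (\<nu> + 1/2) * phi \<nu> 1 x * d_op \<nu> (varphi \<nu> n) x
      = phi_const \<nu> n * wronskian_sys \<nu> (Bessel_node \<nu> 1) (Bessel_node \<nu> n) x"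
      by (intro d_varphi[OF assms]) auto
  next
    fix x assume x: "x \<in> space dx_measure"
    show "x powr (2 * \<nu> + 1) * (phi \<nu> 1 x)\<^sup>2 = (x powr (\<nu> + 1/2) * phi \<nu> 1 x)\<^sup>2"
      using x P by (simp add: power_mult_distrib)
    have "phi \<nu> 1 x \<noteq> 0"
      using x rad_node_1_nz[OF assms, of x] phi_const_nz[OF assms le_refl] phi_eq[OF assms le_refl, of x] by simp
    thus "x powr (\<nu> + 1/2) * phi \<nu> 1 x \<noteq> 0" using x by simp
  qed
  moreover have "orthogonal_system_L2 (mu_measure \<nu>) {2..} (\<lambda>n. delta_op \<nu> (phi \<nu> n))"
    unfolding mu_measure_def
    by (intro orthogonal_system_density[OF orth pm, of _ "phi_const \<nu>"])
      (use assms in \<open>auto simp: delta_phi P\<close>)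
  \<comment> \<open>Writing \<open>dx_measure\<close> with density 1 lets the same transfer absorb
    the constants \<open>phi_const \<nu> n\<close>.\<close>
  moreover have "orthogonal_system_L2 (density dx_measure (\<lambda>x. ennreal 1)) {2..} (\<lambda>n. D_op \<nu> (psi \<nu> n))"
    by (intro orthogonal_system_density[OF orth, of "\<lambda>_. 1" _ "phi_const \<nu>"])
      (use assms in \<open>auto simp: D_psi\<close>)
  ultimately show ?thesis by (simp add: density_1)
qed

end
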